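(* Let $(p,q,r)$, with $p\in\mathbb{R}$ and $q,r\in\mathbb{R}^d$, be in the interior of $\mathcal{K}_{\mathrm{rel}}$. The corresponding primal conjugate gradient $g_{(p,q,r)}=(g_p,g_q,g_r)$ (of the dual barrier $f^*_{\mathrm{rel}}$) is given by $$g_{q_i}=\frac{g_pr_i-1}{q_i},\qquad g_{r_i}=g_p\ln\Big(\frac{g_p}{g_{q_i}}\Big)-g_p-\frac1{r_i}\qquad\forall i\in[d],$$ where $g_p=-1/\hat x$ and $\hat x$ is the root of $$h(x)=d\cdot x+\sum_{i\in[d]}r_i\ln\Big(\frac{r_i}{q_i}+\frac{x}{q_i}\Big)-p.$$ This root can be computed by the one-dimensional Newton–Raphson method, which converges quadratically when started from $x_0=0$.
   Context: $[d]=\{1,\dots,d\}$; $\mathbb{R}^d_{++}$ is the set of vectors with positive entries. Cones: $\mathcal{K}_{\mathrm{rel}}=\mathrm{cl}\{(u,v,w)\in\mathbb{R}\times\mathbb{R}^d_{++}\times\mathbb{R}^d_{++}:u\ge\sum_{i\in[d]}w_i\ln(w_i/v_i)\}$, with dual $\mathcal{K}^*_{\mathrm{rel}}=\mathrm{cl}\{(u,v,w)\in\mathbb{R}_{++}\times\mathbb{R}^d_{++}\times\mathbb{R}^d:w_i\ge u(\ln(u/v_i)-1)\ \forall i\in[d]\}$. Dual barrier, on $\mathrm{int}\,\mathcal{K}^*_{\mathrm{rel}}$: $f^*_{\mathrm{rel}}(u,v,w)=-\sum_{i\in[d]}\ln\big(w_i-u\ln(u/v_i)+u\big)-d\ln(u)-\sum_{i\in[d]}\ln(v_i)$,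 with gradient $g^*=\nabla f^*_{\mathrm{rel}}$. Primal conjugate gradient: for $s$ in the interior of the primal cone $\mathcal{K}$, $g_s=-\arg\max_{y\in\mathrm{int}\,\mathcal{K}^*}\{-\langle s,y\rangle-f^*(y)\}$; equivalently $g_s$ is the vector with $-g_s\in\mathrm{int}\,\mathcal{K}^*$ and $-g^*(-g_s)=s$. The function $h$ is considered on the set of $x\in\mathbb{R}$ with $r_i+x>0$ for all $i$. *)

theory Defs
  imports "HOL-Analysis.Analysis"
begin

text \<open>
  The index set of size \<open>d \<ge> 1\<close> is an arbitrary finite type \<open>'n\<close> with \<open>d = CARD('n)\<close>; a point
  \<open>(u, v, w)\<close> lives in the Euclidean space \<open>real \<times> real^'n \<times> real^'n\<close> with its standard inner
  product. The real logarithm is only ever used for its values at positive arguments.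
\<close>

definition K_rel :: "(real \<times> (real^'n) \<times> (real^'n)) set" where
  "K_rel = closure {(u, v, w). (\<forall>i. 0 < v $ i) \<and> (\<forall>i. 0 < w $ i) \<and>
                               u \<ge> (\<Sum>i\<in>UNIV. w $ i * ln (w $ i / v $ i))}"

definition K_rel_dual :: "(real \<times> (real^'n) \<times> (real^'n)) set" where
  "K_rel_dual = closure {(u, v, w). 0 < u \<and> (\<forall>i. 0 < v $ i) \<and>
                                    (\<forall>i. w $ i \<ge> u * (ln (u / v $ i) - 1))}"

definition f_rel_dual :: "real \<times> (real^'n) \<times> (real^'n) \<Rightarrow> real" where
  "f_rel_dual = (\<lambda>(u, v, w).
     - (\<Sum>i\<in>UNIV. ln (w $ i - u * ln (u / v $ i) + u))
     - real CARD('n) * ln u - (\<Sum>i\<in>UNIV. ln (v $ i)))"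

text \<open>
  \<open>is_conj_grad Kd fd s g\<close>: \<open>- g\<close> maximizes \<open>- \<langle>s, y\<rangle> - fd y\<close> over \<open>y\<close> in the interior of \<open>Kd\<close>.
  It is a relation, so that existence and uniqueness of the maximizer are part of any claim
  that determines \<open>g\<close>.
\<close>

definition is_conj_grad ::
    "'a::real_inner set \<Rightarrow> ('a \<Rightarrow> real) \<Rightarrow> 'a \<Rightarrow> 'a \<Rightarrow> bool" where
  "is_conj_grad Kd fd s g \<longleftrightarrow>
     is_arg_max (\<lambda>y. - (s \<bullet> y) - fd y) (\<lambda>y. y \<in> interior Kd) (- g)"

definition h_dom :: "real^'n \<Rightarrow> real set" where
  "h_dom r = {x. \<forall>i. r $ i + x > 0}"

definition h_fun :: "real \<Rightarrow> real^'n \<Rightarrow> real^'n \<Rightarrow> real \<Rightarrow> real" where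
  "h_fun p q r x =
     real CARD('n) * x + (\<Sum>i\<in>UNIV. r $ i * ln (r $ i / q $ i + x / q $ i)) - p"

definition newton_seq :: "(real \<Rightarrow> real) \<Rightarrow> real \<Rightarrow> nat \<Rightarrow> real" where
  "newton_seq h x0 k = ((\<lambda>x. x - h x / deriv h x) ^^ k) x0"

definition converges_quadratically :: "(nat \<Rightarrow> real) \<Rightarrow> real \<Rightarrow> bool" where
  "converges_quadratically X L \<longleftrightarrow>
     X \<longlonglongrightarrow> L \<and>
     (\<exists>C. \<forall>\<^sub>F k in sequentially. \<bar>X (Suc k) - L\<bar> \<le> C * \<bar>X k - L\<bar>\<^sup>2)"

end

theory Submission
  imports Defs
begin

text \<open>
  Write \<open>\<phi>(a, b) = a ln (a / b)\<close>. Everything about the two cones rests on one inequality,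
  \<open>\<phi>(a, b) \<ge> a (ln t + 1) - b t\<close> for all \<open>t > 0\<close> (\<open>entropy_ge_linear\<close>), with equality at
  \<open>t = a / b\<close>. It exhibits \<open>\<phi>\<close> as a supremum of linear functions, hence as jointly convex. The sets
  whose closures define the cones are therefore convex, and a convex set in a Euclidean space has the
  same interior as its closure; so interior points are those satisfying the defining inequalities
  strictly (\<open>interior_K_rel_imp\<close>, \<open>interior_K_rel_dual\<close>).

  The candidate \<open>(a, b, c) = - (g\<^sub>p, g\<^sub>q, g\<^sub>r)\<close> solves the stationarity equations of the concave
  problem that defines the conjugate gradient. Those in \<open>v\<close> and \<open>w\<close> give \<open>b\<^sub>i = (a r\<^sub>i + 1) / q\<^sub>i\<close> and
  \<open>c\<^sub>i = 1 / r\<^sub>i + a ln (a / b\<^sub>i) - a\<close>; substituting \<open>a = 1 / x\<close> gives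
  \<open>a / b\<^sub>i = q\<^sub>i / (r\<^sub>i + x)\<close>, and the remaining scalar equation is exactly \<open>h x = 0\<close>. That a stationary
  point is the unique global maximizer (\<open>f_rel_dual_strict_max\<close>) needs no second derivatives: the
  loss in objective value equals a sum of terms \<open>x - 1 - ln x\<close> and of gaps in the entropy inequality,
  all nonnegative, and the former vanish only at \<open>x = 1\<close>.

  Finally, \<open>h\<close> is strictly increasing and concave. Since \<open>(p, q, r)\<close> is an interior point,
  \<open>h 0 < 0\<close>, so the root exists, is positive, and Newton's method starts to its left. For an increasing
  concave function the tangents lie above the graph, so the Newton iterates never overshoot the root
  and increase towards it; a quadratic lower bound on \<open>h\<close> gives the quadratic rate
  (\<open>newton_concave_from_left\<close>).
\<close>

section \<open>Joint convexity of relative entropy\<close>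

text \<open>
  Apply \<open>ln x \<le> x - 1\<close> at \<open>x = b t / a\<close> and multiply by \<open>a\<close>. The left-hand side is linear in
  \<open>(a, b)\<close>, which is the point of the estimate.
\<close>
lemma entropy_ge_linear:
  fixes a b t :: real
  assumes "a > 0" "b > 0" "t > 0"
  shows "a * (ln t + 1) - b * t \<le> a * ln (a / b)"
proof -
  have "ln (b * t / a) \<le> b * t / a - 1"
    using assms by (intro ln_le_minus_one) simp
  then have "a * ln (b * t / a) \<le> b * t - a"
    using assms by (simp add: field_simps)
  moreover have "ln (b * t / a) = ln t - ln (a / b)"
    using assms by (simp add: ln_div ln_mult)
  ultimately show ?thesis
    by (simp add: algebra_simps)
qed

lemma convex_combination_pos:
  fixes a b \<alpha> \<beta> :: real
  assumes "a > 0" "b > 0" "\<alpha> \<ge> 0" "\<beta> \<ge> 0" "\<alpha> + \<beta> = 1"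
  shows "\<alpha> * a + \<beta> * b > 0"
  using convex_bound_lt[of "- a" 0 "- b" \<alpha> \<beta>] assms by simp

text \<open>
  The linear bound with \<open>t\<close> the ratio of the two combined arguments is an equality at the
  combination and a lower bound at each of the two points being combined.
\<close>
lemma entropy_jointly_convex:
  fixes a b a' b' \<alpha> \<beta> :: real
  assumes "a > 0" "b > 0" "a' > 0" "b' > 0" and w: "\<alpha> \<ge> 0" "\<beta> \<ge> 0" "\<alpha> + \<beta> = 1"
  shows "(\<alpha> * a + \<beta> * a') * ln ((\<alpha> * a + \<beta> * a') / (\<alpha> * b + \<beta> * b'))
           \<le> \<alpha> * (a * ln (a / b)) + \<beta> * (a' * ln (a' / b'))"
proof -
  define A B where "A = \<alpha> * a + \<beta> * a'" and "B = \<alpha> * b + \<beta> * b'"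
  have AB: "A > 0" "B > 0"
    using assms by (auto simp: A_def B_def intro!: convex_combination_pos)
  have "A * ln (A / B) = A * (ln (A / B) + 1) - B * (A / B)"
    using AB by (simp add: field_simps)
  also have "\<dots> = \<alpha> * (a * (ln (A / B) + 1) - b * (A / B))
                  + \<beta> * (a' * (ln (A / B) + 1) - b' * (A / B))"
    by (subst (1) A_def, subst (2) B_def) (simp only: algebra_simps)
  also have "\<dots> \<le> \<alpha> * (a * ln (a / b)) + \<beta> * (a' * ln (a' / b'))"
    using assms AB by (intro add_mono mult_left_mono entropy_ge_linear) auto
  finally show ?thesis
    by (simp add: A_def B_def)
qed

section \<open>Interiors of the relative entropy cone and its dual\<close>

lemma interior_shift:
  fixes y z :: "'a::real_normed_vector"
  assumes "y \<in> interior S"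
  shows "\<exists>\<epsilon>>0. y - \<epsilon> *\<^sub>R z \<in> S"
proof -
  obtain e where e: "e > 0" "ball y e \<subseteq> S"
    using assms by (auto simp: mem_interior)
  define \<epsilon> where "\<epsilon> = e / (norm z + 1)"
  have pos: "norm z + 1 > 0"
    using norm_ge_zero[of z] by linarith
  have "norm (\<epsilon> *\<^sub>R z) < e"
    using e pos by (simp add: \<epsilon>_def field_simps)
  then have "y - \<epsilon> *\<^sub>R z \<in> S"
    using e(2) by (auto simp: dist_norm subset_iff)
  moreover have "\<epsilon> > 0"
    using e pos by (simp add: \<epsilon>_def)
  ultimately show ?thesis by blast
qed

text \<open>
  An interior point stays in the generating convex set when \<open>p\<close> is decreased a little, which makes the
  inequality between \<open>p\<close> and the relative entropy strict.
\<close>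
lemma interior_K_rel_imp:
  fixes q r :: "real^'n"
  assumes "(p, q, r) \<in> interior K_rel"
  shows "\<forall>i. 0 < q $ i" "\<forall>i. 0 < r $ i" "(\<Sum>i\<in>UNIV. r $ i * ln (r $ i / q $ i)) < p"
proof -
  define C where "C = {(u, v, w). (\<forall>i. 0 < v $ i) \<and> (\<forall>i. 0 < w $ i) \<and>
      u \<ge> (\<Sum>i\<in>UNIV. w $ i * ln (w $ i / (v::real^'n) $ i))}"
  have "convex C"
  proof (rule convexI)
    fix x y :: "real \<times> (real^'n) \<times> (real^'n)" and \<alpha> \<beta> :: real
    assume x: "x \<in> C" and y: "y \<in> C" and w: "0 \<le> \<alpha>" "0 \<le> \<beta>" "\<alpha> + \<beta> = 1"
    obtain u v w u' v' w' where xy: "x = (u, v, w)" "y = (u', v', w')"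
      by (metis prod_cases3)
    have pos: "0 < v $ i" "0 < w $ i" "0 < v' $ i" "0 < w' $ i" for i
      using x y by (auto simp: C_def xy)
    have "(\<Sum>i\<in>UNIV. (\<alpha> * w $ i + \<beta> * w' $ i)
              * ln ((\<alpha> * w $ i + \<beta> * w' $ i) / (\<alpha> * v $ i + \<beta> * v' $ i)))
        \<le> (\<Sum>i\<in>UNIV. \<alpha> * (w $ i * ln (w $ i / v $ i)) + \<beta> * (w' $ i * ln (w' $ i / v' $ i)))"
      using pos w by (intro sum_mono entropy_jointly_convex) auto
    also have "\<dots> = \<alpha> * (\<Sum>i\<in>UNIV. w $ i * ln (w $ i / v $ i))
                   + \<beta> * (\<Sum>i\<in>UNIV. w' $ i * ln (w' $ i / v' $ i))"
      by (simp add: sum.distrib sum_distrib_left)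
    also have "\<dots> \<le> \<alpha> * u + \<beta> * u'"
      using x y w by (intro add_mono mult_left_mono) (auto simp: C_def xy)
    finally show "\<alpha> *\<^sub>R x + \<beta> *\<^sub>R y \<in> C"
      using pos w by (auto simp: C_def xy intro!: convex_combination_pos)
  qed
  then have "(p, q, r) \<in> interior C"
    using assms by (simp add: K_rel_def C_def convex_interior_closure)
  from interior_shift[OF this, of "(1, 0, 0)"]
  obtain \<epsilon> where "\<epsilon> > 0" "(p - \<epsilon>, q, r) \<in> C"
    by auto
  then show "\<forall>i. 0 < q $ i" "\<forall>i. 0 < r $ i" "(\<Sum>i\<in>UNIV. r $ i * ln (r $ i / q $ i)) < p"
    by (auto simp: C_def)
qed

text \<open>
  As for the primal cone, but here both inclusions matter: the maximizer has to be shown to lie in the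
  interior, and its competitors have to satisfy the strict inequalities that make the logarithms of
  the barrier meaningful.
\<close>
lemma interior_K_rel_dual:
  "interior K_rel_dual = {(u, v, w :: real^'n). 0 < u \<and> (\<forall>i. 0 < v $ i) \<and>
                                     (\<forall>i. 0 < w $ i - u * ln (u / v $ i) + u)}"
  (is "_ = ?O")
proof -
  define D where "D = {(u, v, w). 0 < u \<and> (\<forall>i. 0 < v $ i) \<and>
      (\<forall>i. w $ i \<ge> u * (ln (u / (v::real^'n) $ i) - 1))}"
  have "convex D"
  proof (rule convexI)
    fix x y :: "real \<times> (real^'n) \<times> (real^'n)" and \<alpha> \<beta> :: real
    assume x: "x \<in> D" and y: "y \<in> D" and w: "0 \<le> \<alpha>" "0 \<le> \<beta>" "\<alpha> + \<beta> = 1"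
    obtain u v w u' v' w' where xy: "x = (u, v, w)" "y = (u', v', w')"
      by (metis prod_cases3)
    have pos: "0 < u" "0 < u'" "0 < v $ i" "0 < v' $ i" for i
      using x y by (auto simp: D_def xy)
    have "(\<alpha> * u + \<beta> * u') * (ln ((\<alpha> * u + \<beta> * u') / (\<alpha> * v $ i + \<beta> * v' $ i)) - 1)
          \<le> \<alpha> * w $ i + \<beta> * w' $ i" for i
    proof -
      have "(\<alpha> * u + \<beta> * u') * ln ((\<alpha> * u + \<beta> * u') / (\<alpha> * v $ i + \<beta> * v' $ i))
          \<le> \<alpha> * (u * ln (u / v $ i)) + \<beta> * (u' * ln (u' / v' $ i))"
        using pos w by (intro entropy_jointly_convex) auto
      also have "\<dots> \<le> \<alpha> * (w $ i + u) + \<beta> * (w' $ i + u')"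
        using x y w by (intro add_mono mult_left_mono) (auto simp: D_def xy algebra_simps)
      finally show ?thesis
        by (simp add: algebra_simps)
    qed
    then show "\<alpha> *\<^sub>R x + \<beta> *\<^sub>R y \<in> D"
      using pos w by (auto simp: D_def xy intro!: convex_combination_pos)
  qed
  then have "interior K_rel_dual = interior D"
    by (simp add: K_rel_dual_def D_def convex_interior_closure)
  also have "\<dots> = ?O"
  proof (rule interior_unique)
    show "?O \<subseteq> D"
      by (auto simp: D_def algebra_simps less_imp_le)
    define U where "U = {y :: real \<times> (real^'n) \<times> (real^'n). 0 < fst y \<and> (\<forall>i. 0 < fst (snd y) $ i)}"
    have "U = {y. 0 < fst y} \<inter> (\<Inter>i. {y. 0 < fst (snd y) $ i})"
      by (auto simp: U_def)
    then have U: "open U"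
      by (auto intro!: open_Int open_INT open_Collect_less continuous_intros)
    define F where "F i = (\<lambda>y :: real \<times> (real^'n) \<times> (real^'n).
        snd (snd y) $ i - fst y * ln (fst y / fst (snd y) $ i) + fst y)" for i
    have cont: "continuous_on U (F i)" for i
      unfolding F_def U_def
      by (intro continuous_intros) (auto simp: less_imp_neq[symmetric])
    have "?O = (\<Inter>i. U \<inter> F i -` {0<..})"
      by (auto simp: U_def F_def)
    moreover have "open (U \<inter> F i -` {0<..})" for i
      using cont U by (intro continuous_open_preimage) auto
    then have "open (\<Inter>i. U \<inter> F i -` {0<..})"
      by (intro open_INT) auto
    ultimately show "open ?O"
      by simp
  next
    fix T assume T: "T \<subseteq> D" "open T"
    \<comment> \<open>A point of the interior of \<open>D\<close> stays in \<open>D\<close> when every entry of \<open>w\<close> is decreased slightly,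
      so its weak inequalities are strict.\<close>
    show "T \<subseteq> ?O"
    proof
      fix y assume "y \<in> T"
      then have "y \<in> interior D"
        using T by (meson interior_maximal subsetD)
      moreover obtain u v w where y: "y = (u, v, w)"
        by (metis prod_cases3)
      ultimately obtain \<epsilon> where "\<epsilon> > 0" "(u, v, w - \<epsilon> *\<^sub>R (\<chi> i. 1)) \<in> D"
        using interior_shift[of y D "(0, 0, \<chi> i. 1)"] by auto
      then have "0 < u" "0 < v $ i" "0 < w $ i - u * ln (u / v $ i) + u" for i
        by (auto simp: D_def algebra_simps) (smt (verit, best))
      then show "y \<in> ?O"
        by (auto simp: y)
    qed
  qed
  finally show ?thesis .
qed

section \<open>Stationary points of the conjugate problem\<close>

lemma is_conj_grad_unique:
  assumes "- g \<in> interior Kd"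
    and "\<And>y. y \<in> interior Kd \<Longrightarrow> y \<noteq> - g \<Longrightarrow> - (s \<bullet> y) - f y < - (s \<bullet> (- g)) - f (- g)"
  shows "is_conj_grad Kd f s g' \<longleftrightarrow> g' = g"
  unfolding is_conj_grad_def is_arg_max_def
  using assms by (metis less_asym less_irrefl neg_equal_iff_equal)

text \<open>
  The hypotheses \<open>stat_w\<close>, \<open>stat_v\<close>, \<open>stat_u\<close> say that the gradient of the objective vanishes at
  \<open>(a, b, c)\<close>. They turn the linear term \<open>\<langle>(p, q, r), (u, v, w) - (a, b, c)\<rangle>\<close> into exactly the
  linear part of the estimates \<open>ln x \<le> x - 1\<close> for the barrier's logarithms, taken relative to their
  values at \<open>(a, b, c)\<close>, together with the linear bound on \<open>u ln (u / v\<^sub>i)\<close> that touches at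
  \<open>(a, b\<^sub>i)\<close>. So the difference of the two objective values is the sum of the slacks of these
  inequalities.
\<close>
lemma f_rel_dual_strict_max:
  fixes q r v w b c :: "real^'n"
  assumes y: "(u, v, w) \<in> interior K_rel_dual" and z: "(a, b, c) \<in> interior K_rel_dual"
    and stat_w: "\<And>i. r $ i = 1 / (c $ i - a * ln (a / b $ i) + a)"
    and stat_v: "\<And>i. q $ i = r $ i * (a / b $ i) + 1 / b $ i"
    and stat_u: "p = real CARD('n) / a - (\<Sum>i\<in>UNIV. r $ i * ln (a / b $ i))"
    and ne: "(u, v, w) \<noteq> (a, b, c)"
  shows "- ((p, q, r) \<bullet> (u, v, w)) - f_rel_dual (u, v, w)
           < - ((p, q, r) \<bullet> (a, b, c)) - f_rel_dual (a, b, c)"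
proof -
  \<comment> \<open>\<open>Z\<close> and \<open>R\<close> are the arguments of the first logarithm of the barrier at the two points,
    \<open>G\<close> collects the slacks of the three logarithmic estimates, \<open>E\<close> those of the entropy bound.\<close>
  define Z where "Z = (\<lambda>i. w $ i - u * ln (u / v $ i) + u)"
  define R where "R = (\<lambda>i. c $ i - a * ln (a / b $ i) + a)"
  have posy: "0 < u" "0 < v $ i" "0 < Z i" for i
    using y by (auto simp: interior_K_rel_dual Z_def)
  have posz: "0 < a" "0 < b $ i" "0 < R i" for i
    using z by (auto simp: interior_K_rel_dual R_def)
  have rR: "r $ i = 1 / R i" for i
    using stat_w by (simp add: R_def)
  have rpos: "0 < r $ i" for i
    using posz by (simp add: rR)
  define G where "G = (\<lambda>i. (r $ i * Z i - 1 - ln (r $ i * Z i)) + (u / a - 1 - ln (u / a)) +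
      (v $ i / b $ i - 1 - ln (v $ i / b $ i)))"
  define E where "E = (\<lambda>i. r $ i * (u * ln (u / v $ i) - u * (ln (a / b $ i) + 1) + v $ i * (a / b $ i)))"
  have E: "E i \<ge> 0" for i
    using entropy_ge_linear[of u "v $ i" "a / b $ i"] posy posz rpos[of i]
    by (simp add: E_def)
  have slack: "x - 1 - ln x \<ge> 0" if "x > 0" for x :: real
    using ln_le_minus_one[OF that] by simp
  have G: "G i \<ge> 0" for i
    unfolding G_def using posy posz rpos by (intro add_nonneg_nonneg slack) auto
  have key: "(p * a + (\<Sum>i\<in>UNIV. q $ i * b $ i) + (\<Sum>i\<in>UNIV. r $ i * c $ i) + f_rel_dual (a, b, c))
      + (\<Sum>i\<in>UNIV. G i + E i)
      = p * u + (\<Sum>i\<in>UNIV. q $ i * v $ i) + (\<Sum>i\<in>UNIV. r $ i * w $ i) + f_rel_dual (u, v, w)"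
  proof -
    have p: "p = (\<Sum>i\<in>UNIV. 1 / a - r $ i * ln (a / b $ i))"
      by (simp add: stat_u sum_subtractf)
    have f: "f_rel_dual (a, b, c) = (\<Sum>i\<in>UNIV. - ln (R i) - ln a - ln (b $ i))"
      "f_rel_dual (u, v, w) = (\<Sum>i\<in>UNIV. - ln (Z i) - ln u - ln (v $ i))"
      by (simp_all add: f_rel_dual_def R_def Z_def sum_subtractf sum_negf)
    have "((1 / a - r $ i * ln (a / b $ i)) * a + q $ i * b $ i + r $ i * c $ i
             + (- ln (R i) - ln a - ln (b $ i))) + (G i + E i)
        = (1 / a - r $ i * ln (a / b $ i)) * u + q $ i * v $ i + r $ i * w $ i
             + (- ln (Z i) - ln u - ln (v $ i))" for i
    proof -
      have c: "r $ i * c $ i = 1 + r $ i * a * ln (a / b $ i) - r $ i * a"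
      proof -
        have "r $ i * R i = 1" using posz(3)[of i] by (simp add: rR)
        then show ?thesis by (simp add: R_def algebra_simps)
      qed
      have w: "r $ i * w $ i = r $ i * Z i + r $ i * u * ln (u / v $ i) - r $ i * u"
        by (simp add: Z_def algebra_simps)
      have qb: "q $ i * b $ i = r $ i * a + 1"
        using posz(2)[of i] by (simp add: stat_v field_simps)
      have qv: "q $ i * v $ i = r $ i * (v $ i * (a / b $ i)) + v $ i / b $ i"
        by (simp add: stat_v field_simps)
      have lns: "ln (r $ i * Z i) = ln (Z i) - ln (R i)" "ln (u / a) = ln u - ln a"
        "ln (v $ i / b $ i) = ln (v $ i) - ln (b $ i)"
        using posy(1) posz(1) posz(2,3)[of i] posy(2,3)[of i] by (simp_all add: rR ln_mult ln_div)
      have "1 / a * a = 1" using posz(1) by simp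
      then show ?thesis
        unfolding c w qb qv G_def E_def lns
        by (simp only: left_diff_distrib) (simp add: algebra_simps)
    qed
    then show ?thesis
      unfolding p f sum_distrib_right sum.distrib[symmetric] by simp
  qed
  have "(\<Sum>i\<in>UNIV. G i + E i) > 0"
  proof -
    \<comment> \<open>If all logarithmic slacks vanish, then \<open>Z\<close>, \<open>u\<close> and \<open>v\<close> agree with \<open>R\<close>, \<open>a\<close> and \<open>b\<close>, and
      then \<open>w\<close> agrees with \<open>c\<close> as well.\<close>
    have "\<exists>i. G i \<noteq> 0"
    proof (rule ccontr)
      assume "\<not> ?thesis"
      then have G0: "G i = 0" for i by simp
      have zero: "x = 1" if "x > 0" "x - 1 - ln x = 0" for x :: real
        using that ln_eq_minus_one by simp
      have "r $ i * Z i = 1 \<and> u / a = 1 \<and> v $ i / b $ i = 1" for i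
      proof -
        have "r $ i * Z i > 0" "u / a > 0" "v $ i / b $ i > 0"
          using posy posz rpos by auto
        with G0[of i] show ?thesis
          unfolding G_def by (smt (verit) slack zero)
      qed
      then have *: "Z i = R i" "u = a" "v $ i = b $ i" for i
        using posz(1) posz(2,3)[of i] by (auto simp: rR field_simps)
      have "v = b"
        using * by (simp add: vec_eq_iff)
      moreover have "w = c"
        using *(1) by (simp add: Z_def R_def vec_eq_iff * )
      ultimately show False
        using ne * by simp
    qed
    then obtain i where "G i \<noteq> 0" ..
    with G[of i] E[of i] have "0 < G i + E i"
      by linarith
    then show ?thesis
      using G E by (intro sum_pos2[of UNIV i]) auto
  qed
  with key show ?thesis
    by (simp add: inner_vec_def)
qed

section \<open>Newton's method for a concave function\<close>

text \<open>
  Concavity enters only through the tangent inequality, which makes \<open>h'\<close> nonincreasing. The tangent at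
  an iterate \<open>x\<close> lies above the graph, so its zero is at most \<open>L\<close>; and since \<open>h x \<le> 0\<close>, the step goes
  to the right. The step has length at least \<open>(h' L / h' a) (L - x)\<close>, so the error shrinks
  geometrically. The quadratic rate follows because \<open>h' x\<close> times the new error is the gap at \<open>L\<close>
  between the tangent and \<open>h\<close>, which the last hypothesis bounds by \<open>C (L - x)\<^sup>2\<close>.
\<close>
lemma newton_concave_from_left:
  fixes h h' :: "real \<Rightarrow> real"
  assumes "a \<le> L" and root: "h L = 0"
    and deriv: "\<And>x. x \<in> {a..L} \<Longrightarrow> (h has_real_derivative h' x) (at x)"
    and pos: "h' L > 0"
    and tangent: "\<And>x y. x \<in> {a..L} \<Longrightarrow> y \<in> {a..L} \<Longrightarrow> h y \<le> h x + h' x * (y - x)"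
    and minorant: "\<And>x. x \<in> {a..L} \<Longrightarrow> h x + h' x * (L - x) - C * (L - x)\<^sup>2 \<le> h L"
  shows "newton_seq h a k \<in> {a..L}" and "converges_quadratically (newton_seq h a) L"
proof -
  define X where "X = newton_seq h a"
  define N where "N x = x - h x / h' x" for x
  have X0: "X 0 = a"
    by (simp add: X_def newton_seq_def)
  have antitone: "h' y \<le> h' x" if "x \<in> {a..L}" "y \<in> {a..L}" "x \<le> y" for x y
  proof (cases "x = y")
    case False
    have "(h' y - h' x) * (y - x) \<le> 0"
      using tangent[of x y] tangent[of y x] that by (simp add: algebra_simps)
    then show ?thesis
      using False that by (simp add: mult_le_0_iff)
  qed simp
  have slope: "h' L \<le> h' x" "h' x \<le> h' a" "0 < h' x" if "x \<in> {a..L}" for x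
    using antitone[of x L] antitone[of a x] that pos by auto
  have N_in: "N x \<in> {a..L}" if x: "x \<in> {a..L}" for x
  proof -
    have "h x \<le> 0"
      using tangent[of L x] x root pos by (auto simp: mult_nonneg_nonpos intro: order_trans)
    then have "x \<le> N x"
      using slope(3)[OF x] by (simp add: N_def divide_nonpos_pos)
    moreover have "N x \<le> L"
    proof -
      have "0 \<le> h x + h' x * (L - x)"
        using tangent[of x L] x root by simp
      then show ?thesis
        using slope(3)[OF x] by (simp add: N_def field_simps)
    qed
    ultimately show ?thesis
      using x by auto
  qed
  have step: "X (Suc k) = N (X k)" if "X k \<in> {a..L}" for k
    using DERIV_imp_deriv[OF deriv[OF that]] by (simp add: X_def newton_seq_def N_def)
  have X_in: "X k \<in> {a..L}" for k
  proof (induction k)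
    case 0
    then show ?case using \<open>a \<le> L\<close> by (simp add: X0)
  next
    case (Suc k)
    then show ?case using N_in step by simp
  qed
  then show "newton_seq h a k \<in> {a..L}"
    by (simp add: X_def)
  define \<theta> where "\<theta> = 1 - h' L / h' a"
  have \<theta>: "0 \<le> \<theta>" "\<theta> < 1"
    using slope[of a] \<open>a \<le> L\<close> pos by (auto simp: \<theta>_def)
  have linear: "L - X (Suc k) \<le> \<theta> * (L - X k)" for k
  proof -
    let ?x = "X k"
    have "h' L * (L - ?x) \<le> - h ?x"
      using tangent[of L ?x] X_in[of k] root by (simp add: algebra_simps)
    then have "h' L * (L - ?x) / h' a \<le> - h ?x / h' a"
      using slope(3)[of a] \<open>a \<le> L\<close> by (intro divide_right_mono) auto
    then have "h' L / h' a * (L - ?x) \<le> - h ?x / h' a"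
      by simp
    also have "\<dots> \<le> - h ?x / h' ?x"
    proof (rule divide_left_mono)
      show "0 \<le> - h ?x"
        using \<open>h' L * (L - ?x) \<le> - h ?x\<close> X_in[of k] pos
        by (meson atLeastAtMost_iff diff_ge_0_iff_ge less_imp_le mult_nonneg_nonneg order_trans)
    qed (use slope[OF X_in[of k]] slope[of a] \<open>a \<le> L\<close> in auto)
    finally have "h' L / h' a * (L - ?x) \<le> X (Suc k) - ?x"
      by (simp add: step[OF X_in] N_def)
    then show ?thesis
      by (simp add: \<theta>_def left_diff_distrib)
  qed
  have geometric: "L - X k \<le> \<theta> ^ k * (L - a)" for k
  proof (induction k)
    case (Suc k)
    have "L - X (Suc k) \<le> \<theta> * (L - X k)"
      by (rule linear)
    also have "\<dots> \<le> \<theta> * (\<theta> ^ k * (L - a))"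
      using Suc \<theta> by (intro mult_left_mono)
    finally show ?case by simp
  qed (simp add: X0)
  have "X \<longlonglongrightarrow> L"
  proof -
    have "(\<lambda>k. L - X k) \<longlonglongrightarrow> 0"
    proof (rule tendsto_sandwich)
      show "(\<lambda>_. 0) \<longlonglongrightarrow> (0 :: real)"
        by simp
      show "(\<lambda>k. \<theta> ^ k * (L - a)) \<longlonglongrightarrow> 0"
        using \<theta> by (intro tendsto_mult_left_zero LIMSEQ_power_zero) simp
    qed (use X_in geometric in auto)
    from tendsto_diff[OF tendsto_const this, of L] show ?thesis by simp
  qed
  moreover have "\<bar>X (Suc k) - L\<bar> \<le> (\<bar>C\<bar> / h' L) * \<bar>X k - L\<bar>\<^sup>2" for k
  proof -
    let ?x = "X k"
    have x: "?x \<in> {a..L}" by (rule X_in)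
    have "h' ?x * (L - N ?x) = h ?x + h' ?x * (L - ?x)"
      using slope(3)[OF x] by (simp add: N_def field_simps)
    also have "\<dots> \<le> C * (L - ?x)\<^sup>2"
      using minorant[OF x] root by simp
    also have "\<dots> \<le> \<bar>C\<bar> * (L - ?x)\<^sup>2"
      by (intro mult_right_mono) auto
    finally have upper: "h' ?x * (L - N ?x) \<le> \<bar>C\<bar> * (L - ?x)\<^sup>2" .
    have "h' L * (L - N ?x) \<le> h' ?x * (L - N ?x)"
      using slope(1)[OF x] N_in[OF x] by (intro mult_right_mono) auto
    with upper have "h' L * (L - N ?x) \<le> \<bar>C\<bar> * (L - ?x)\<^sup>2"
      by linarith
    then have "L - N ?x \<le> \<bar>C\<bar> / h' L * (L - ?x)\<^sup>2"
      using pos by (simp add: field_simps)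
    moreover have "\<bar>X (Suc k) - L\<bar> = L - N ?x"
      using N_in[OF x] step[OF x] by simp
    ultimately show ?thesis
      by (simp add: power2_commute)
  qed
  then have "\<forall>\<^sub>F k in sequentially. \<bar>X (Suc k) - L\<bar> \<le> (\<bar>C\<bar> / h' L) * \<bar>X k - L\<bar>\<^sup>2"
    by (intro always_eventually allI)
  ultimately show "converges_quadratically (newton_seq h a) L"
    unfolding converges_quadratically_def X_def by blast
qed

section \<open>The scalar equation and the conjugate gradient\<close>

lemma ln_tangent:
  fixes x y :: real
  assumes "x > 0" "y > 0"
  shows "ln y \<le> ln x + (y - x) / x"
proof -
  have "ln (y / x) \<le> y / x - 1"
    using assms by (intro ln_le_minus_one) simp
  then show ?thesis
    using assms by (simp add: ln_div diff_divide_distrib)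
qed

text \<open>
  By the tangent at \<open>y\<close>, \<open>ln y - ln x \<ge> (y - x) / y\<close>, and this differs from \<open>(y - x) / x\<close> by
  \<open>(y - x)\<^sup>2 / (x y)\<close>.
\<close>
lemma ln_quadratic_minorant:
  fixes m x y :: real
  assumes "0 < m" "m \<le> x" "m \<le> y"
  shows "ln x + (y - x) / x - (y - x)\<^sup>2 / m\<^sup>2 \<le> ln y"
proof -
  have "(y - x) / x - (y - x) / y = (y - x)\<^sup>2 / (x * y)"
    using assms by (simp add: field_simps power2_eq_square)
  also have "\<dots> \<le> (y - x)\<^sup>2 / m\<^sup>2"
    using assms by (intro divide_left_mono) (auto simp: power2_eq_square intro!: mult_mono)
  finally show ?thesis
    using ln_tangent[of y x] assms by (simp add: diff_divide_distrib)
qed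

definition h_slope :: "real^'n \<Rightarrow> real \<Rightarrow> real" where
  "h_slope r x = real CARD('n) + (\<Sum>i\<in>UNIV. r $ i / (r $ i + x))"

context
  fixes p :: real and q r :: "real^'n"
  assumes q: "\<forall>i. 0 < q $ i" and r: "\<forall>i. 0 < r $ i"
begin

lemma h_fun_eq:
  assumes "x \<in> h_dom r"
  shows "h_fun p q r x = real CARD('n) * x + (\<Sum>i\<in>UNIV. r $ i * (ln (r $ i + x) - ln (q $ i))) - p"
proof -
  have "ln (r $ i / q $ i + x / q $ i) = ln (r $ i + x) - ln (q $ i)" for i
    using assms q[rule_format, of i]
    by (simp add: h_dom_def ln_divide_pos add_divide_distrib[symmetric])
  then show ?thesis
    by (simp add: h_fun_def)
qed

lemma h_slope_pos:
  assumes "x \<in> h_dom r"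
  shows "0 < h_slope r x"
  using assms r by (auto simp: h_slope_def h_dom_def less_imp_le intro!: add_pos_nonneg sum_nonneg)

lemma h_fun_has_derivative:
  assumes "x \<in> h_dom r"
  shows "(h_fun p q r has_real_derivative h_slope r x) (at x)"
proof -
  have pos: "0 < r $ i / q $ i + x / q $ i" for i
    using assms q by (simp add: h_dom_def add_divide_distrib[symmetric])
  have q0: "q $ i \<noteq> 0" for i
    using q[rule_format, of i] by simp
  have "(h_fun p q r has_real_derivative
          real CARD('n) + (\<Sum>i\<in>UNIV. r $ i * ((1 / q $ i) / (r $ i / q $ i + x / q $ i)))) (at x)"
    unfolding h_fun_def by (auto intro!: derivative_eq_intros pos simp: q0 mult.commute)
  moreover have "(1 / q $ i) / (r $ i / q $ i + x / q $ i) = 1 / (r $ i + x)" for i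
    using q[rule_format, of i] by (simp add: add_divide_distrib[symmetric])
  ultimately show ?thesis
    by (simp add: h_slope_def)
qed

lemma h_fun_tangent:
  assumes "x \<in> h_dom r" "y \<in> h_dom r"
  shows "h_fun p q r y \<le> h_fun p q r x + h_slope r x * (y - x)"
proof -
  have "(\<Sum>i\<in>UNIV. r $ i * (ln (r $ i + y) - ln (q $ i)))
        \<le> (\<Sum>i\<in>UNIV. r $ i * (ln (r $ i + x) - ln (q $ i)) + r $ i / (r $ i + x) * (y - x))"
  proof (rule sum_mono)
    fix i
    have "r $ i * ln (r $ i + y) \<le> r $ i * (ln (r $ i + x) + (y - x) / (r $ i + x))"
      using assms ln_tangent[of "r $ i + x" "r $ i + y"] r
      by (intro mult_left_mono) (auto simp: h_dom_def less_imp_le)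
    then show "r $ i * (ln (r $ i + y) - ln (q $ i))
        \<le> r $ i * (ln (r $ i + x) - ln (q $ i)) + r $ i / (r $ i + x) * (y - x)"
      by (simp add: algebra_simps)
  qed
  then show ?thesis
    unfolding h_fun_eq[OF assms(1)] h_fun_eq[OF assms(2)] h_slope_def sum.distrib
      sum_distrib_right[symmetric]
    by (simp only: distrib_right right_diff_distrib)
qed

text \<open>
  For nonnegative arguments every \<open>r\<^sub>i + x\<close> is at least \<open>r\<^sub>i\<close>, which makes the error constant
  uniform in \<open>x\<close>.
\<close>
lemma h_fun_minorant:
  assumes "0 \<le> x" "0 \<le> y"
  shows "h_fun p q r x + h_slope r x * (y - x) - (\<Sum>i\<in>UNIV. 1 / r $ i) * (y - x)\<^sup>2 \<le> h_fun p q r y"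
proof -
  have dom: "x \<in> h_dom r" "y \<in> h_dom r"
    using assms r by (auto simp: h_dom_def add_pos_nonneg)
  have "(\<Sum>i\<in>UNIV. r $ i * (ln (r $ i + x) - ln (q $ i)) + r $ i / (r $ i + x) * (y - x)
            - 1 / r $ i * (y - x)\<^sup>2)
        \<le> (\<Sum>i\<in>UNIV. r $ i * (ln (r $ i + y) - ln (q $ i)))"
  proof (rule sum_mono)
    fix i
    have ri: "0 < r $ i" using r by simp
    have "r $ i * (ln (r $ i + x) + (y - x) / (r $ i + x) - (y - x)\<^sup>2 / (r $ i)\<^sup>2)
          \<le> r $ i * ln (r $ i + y)"
      using assms ln_quadratic_minorant[of "r $ i" "r $ i + x" "r $ i + y"] ri
      by (intro mult_left_mono) auto
    moreover have "r $ i * ((y - x)\<^sup>2 / (r $ i)\<^sup>2) = 1 / r $ i * (y - x)\<^sup>2"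
      using ri by (simp add: power2_eq_square)
    ultimately show "r $ i * (ln (r $ i + x) - ln (q $ i)) + r $ i / (r $ i + x) * (y - x)
            - 1 / r $ i * (y - x)\<^sup>2 \<le> r $ i * (ln (r $ i + y) - ln (q $ i))"
      by (simp add: right_diff_distrib[of "r $ i"] distrib_left)
  qed
  then show ?thesis
    unfolding h_fun_eq[OF dom(1)] h_fun_eq[OF dom(2)] h_slope_def sum.distrib sum_subtractf
      sum_distrib_right[symmetric]
    by (simp only: distrib_right right_diff_distrib)
qed

text \<open>
  Uniqueness holds because \<open>h\<close> is strictly increasing. For existence, \<open>h 0 < 0\<close> by the hypothesis on
  \<open>p\<close>, and \<open>h x \<ge> h 0 + d x\<close> for \<open>x \<ge> 0\<close> since the logarithms increase.
\<close>
lemma h_fun_unique_root: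
  assumes p: "(\<Sum>i\<in>UNIV. r $ i * ln (r $ i / q $ i)) < p"
  obtains xh where "0 < xh" "{x \<in> h_dom r. h_fun p q r x = 0} = {xh}"
proof -
  have nonneg_dom: "x \<in> h_dom r" if "0 \<le> x" for x
    using that r by (auto simp: h_dom_def add_pos_nonneg)
  have strict: "h_fun p q r x < h_fun p q r y" if "x \<in> h_dom r" "y \<in> h_dom r" "x < y" for x y
  proof -
    have "0 < h_slope r y * (y - x)"
      using h_slope_pos[OF that(2)] that(3) by simp
    with h_fun_tangent[OF that(2,1)] show ?thesis
      by (simp add: algebra_simps)
  qed
  \<comment> \<open>The zero of the linear lower bound \<open>h 0 + d x\<close> lies to the right of the root of \<open>h\<close>.\<close>
  define x1 where "x1 = - h_fun p q r 0 / real CARD('n)"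
  have h0: "h_fun p q r 0 < 0"
    using p by (simp add: h_fun_def)
  then have x1: "0 < x1"
    by (simp add: x1_def divide_neg_pos)
  have "0 \<le> h_fun p q r x1"
  proof -
    have "r $ i * ln (r $ i / q $ i) \<le> r $ i * ln (r $ i / q $ i + x1 / q $ i)" for i
    proof (intro mult_left_mono ln_mono)
      show "0 < r $ i / q $ i" "r $ i / q $ i \<le> r $ i / q $ i + x1 / q $ i" "0 \<le> r $ i"
        using q[rule_format, of i] r[rule_format, of i] x1 by auto
    qed
    then have "h_fun p q r 0 + real CARD('n) * x1 \<le> h_fun p q r x1"
      by (auto simp: h_fun_def intro!: sum_mono)
    then show ?thesis
      by (simp add: x1_def)
  qed
  moreover have "continuous_on {0..x1} (h_fun p q r)"
    by (intro continuous_at_imp_continuous_on ballI DERIV_isCont[OF h_fun_has_derivative] nonneg_dom) simp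
  ultimately obtain xh where xh: "0 \<le> xh" "h_fun p q r xh = 0"
    using IVT'[of "h_fun p q r" 0 0 x1] h0 x1 by auto
  show thesis
  proof
    show "0 < xh"
      using xh h0 by (cases "xh = 0") auto
    show "{x \<in> h_dom r. h_fun p q r x = 0} = {xh}"
      using xh nonneg_dom strict by (auto, metis linorder_neqE less_irrefl)
  qed
qed

lemma newton_h_fun:
  assumes "0 < xh" "h_fun p q r xh = 0"
  shows "newton_seq (h_fun p q r) 0 k \<in> {0..xh}"
    and "converges_quadratically (newton_seq (h_fun p q r) 0) xh"
proof -
  have dom: "x \<in> h_dom r" if "x \<in> {0..xh}" for x
    using that r by (auto simp: h_dom_def add_pos_nonneg)
  have *: "h_slope r xh > 0"
    using assms by (intro h_slope_pos dom) auto
  note N = newton_concave_from_left[of 0 xh "h_fun p q r" "h_slope r" "\<Sum>i\<in>UNIV. 1 / r $ i",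
      OF _ assms(2) h_fun_has_derivative[OF dom] * h_fun_tangent[OF dom dom] h_fun_minorant]
  show "newton_seq (h_fun p q r) 0 k \<in> {0..xh}"
    using assms by (intro N) auto
  show "converges_quadratically (newton_seq (h_fun p q r) 0) xh"
    using assms by (intro N) auto
qed

text \<open>
  The formulas define a vector whose negative \<open>(a, b, c)\<close> is stationary: \<open>stat_w\<close> and \<open>stat_v\<close> hold by
  the choice of \<open>c\<close> and \<open>b\<close>, and \<open>stat_u\<close> is the equation \<open>h xh = 0\<close>.
\<close>
lemma is_conj_grad_rel_iff:
  assumes xh: "0 < xh" "h_fun p q r xh = 0"
  shows "is_conj_grad K_rel_dual f_rel_dual (p, q, r) (gp, gq, gr) \<longleftrightarrow>
       gp = - 1 / xh \<and>
       (\<forall>i. gq $ i = (gp * r $ i - 1) / q $ i) \<and>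
       (\<forall>i. gr $ i = gp * ln (gp / gq $ i) - gp - 1 / r $ i)"
proof -
  define a where "a = 1 / xh"
  define b where "b = (\<chi> i. (a * r $ i + 1) / q $ i)"
  define c where "c = (\<chi> i. 1 / r $ i + a * ln (a / b $ i) - a)"
  have a: "0 < a"
    using xh by (simp add: a_def)
  have b: "0 < b $ i" for i
    using a q r by (simp add: b_def add_pos_pos)
  have R: "c $ i - a * ln (a / b $ i) + a = 1 / r $ i" for i
    by (simp add: c_def)
  have ratio: "a / b $ i = q $ i / (r $ i + xh)" for i
    using q[rule_format, of i] r[rule_format, of i] xh by (simp add: a_def b_def field_simps)
  have z: "(a, b, c) \<in> interior K_rel_dual"
    using a b r by (simp add: interior_K_rel_dual R)
  have stat_v: "q $ i = r $ i * (a / b $ i) + 1 / b $ i" for i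
  proof -
    have "q $ i * b $ i = a * r $ i + 1"
      using q[rule_format, of i] by (simp add: b_def)
    then show ?thesis
      using b[of i] by (simp add: field_simps)
  qed
  have stat_u: "p = real CARD('n) / a - (\<Sum>i\<in>UNIV. r $ i * ln (a / b $ i))"
  proof -
    have "xh \<in> h_dom r"
      using xh r by (auto simp: h_dom_def add_pos_pos)
    moreover have "ln (a / b $ i) = ln (q $ i) - ln (r $ i + xh)" for i
      using q[rule_format, of i] r[rule_format, of i] xh by (simp add: ratio ln_div)
    ultimately show ?thesis
      using xh(2) by (simp add: h_fun_eq a_def right_diff_distrib sum_subtractf)
  qed
  have "is_conj_grad K_rel_dual f_rel_dual (p, q, r) (gp, gq, gr) \<longleftrightarrow> (gp, gq, gr) = (- a, - b, - c)"
  proof (rule is_conj_grad_unique)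
    fix y :: "real \<times> (real^'n) \<times> (real^'n)"
    assume "y \<in> interior K_rel_dual" "y \<noteq> - (- a, - b, - c)"
    moreover obtain u v w where "y = (u, v, w)"
      by (metis prod_cases3)
    ultimately show "- ((p, q, r) \<bullet> y) - f_rel_dual y
        < - ((p, q, r) \<bullet> - (- a, - b, - c)) - f_rel_dual (- (- a, - b, - c))"
      using f_rel_dual_strict_max[OF _ z _ stat_v stat_u] by (simp add: R)
  qed (use z in simp)
  also have "\<dots> \<longleftrightarrow> gp = - 1 / xh \<and>
       (\<forall>i. gq $ i = (gp * r $ i - 1) / q $ i) \<and>
       (\<forall>i. gr $ i = gp * ln (gp / gq $ i) - gp - 1 / r $ i)"
  proof -
    have bq: "- b $ i = (- a * r $ i - 1) / q $ i" for i
      by (simp add: b_def minus_divide_left)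
    have "- c $ i = - a * ln (- a / (- b $ i)) - - a - 1 / r $ i" for i
      by (simp add: c_def)
    with bq show ?thesis
      by (auto simp: vec_eq_iff a_def)
  qed
  finally show ?thesis .
qed

end

text \<open>
  The Newton iterates lie between \<open>0\<close> and the root, hence in the domain of \<open>h\<close>, where \<open>h\<close> is
  differentiable with positive derivative; so every Newton step is well defined.
\<close>
theorem theorem7:
  fixes p :: real and q r :: "real^'n"
  assumes "(p, q, r) \<in> interior K_rel"
  shows "\<exists>xh.
    {x \<in> h_dom r. h_fun p q r x = 0} = {xh} \<and>
    (\<forall>gp gq gr. is_conj_grad K_rel_dual f_rel_dual (p, q, r) (gp, gq, gr) \<longleftrightarrow>
       gp = - 1 / xh \<and>
       (\<forall>i. gq $ i = (gp * r $ i - 1) / q $ i) \<and>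
       (\<forall>i. gr $ i = gp * ln (gp / gq $ i) - gp - 1 / r $ i)) \<and>
    (\<forall>k. newton_seq (h_fun p q r) 0 k \<in> h_dom r \<and>
         h_fun p q r differentiable (at (newton_seq (h_fun p q r) 0 k)) \<and>
         deriv (h_fun p q r) (newton_seq (h_fun p q r) 0 k) \<noteq> 0) \<and>
    converges_quadratically (newton_seq (h_fun p q r) 0) xh"
proof -
  note pos = interior_K_rel_imp[OF assms]
  obtain xh where xh: "0 < xh" "{x \<in> h_dom r. h_fun p q r x = 0} = {xh}"
    using h_fun_unique_root[OF pos] by blast
  then have root: "h_fun p q r xh = 0"
    by blast
  have dom: "newton_seq (h_fun p q r) 0 k \<in> h_dom r" for k
    using newton_h_fun(1)[OF pos(1,2) xh(1) root, of k] pos(2)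
    by (auto simp: h_dom_def add_pos_nonneg)
  show ?thesis
  proof (intro exI[of _ xh] conjI allI)
    fix k
    let ?x = "newton_seq (h_fun p q r) 0 k"
    show "?x \<in> h_dom r"
      by (rule dom)
    have D: "(h_fun p q r has_real_derivative h_slope r ?x) (at ?x)"
      by (rule h_fun_has_derivative[OF pos(1,2) dom])
    then show "h_fun p q r differentiable (at ?x)"
      by (auto simp: real_differentiable_def)
    show "deriv (h_fun p q r) ?x \<noteq> 0"
      using DERIV_imp_deriv[OF D] h_slope_pos[OF pos(1,2) dom, of k] by simp
  qed (use xh(2) is_conj_grad_rel_iff[OF pos(1,2) xh(1) root] newton_h_fun(2)[OF pos(1,2) xh(1) root]
       in auto)
qed

end
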